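(* If $f:\mathbb{N}\to\mathbb{R}^{+}$ is a function such that $f(n)\ge n+1$ for any $n\in\mathbb{N}$ and $E_0(f)>0$, then $E_W(f)>0$.
   Context: Here $\mathbb{N}=\{0,1,2,\dots\}$, $\log$ is the natural logarithm, $q\ge2$ is a fixed integer and $A=\{0,1,\dots,q-1\}$. For an infinite word $w\in A^{\mathbb{N}}$, $p_w(n)$ is the number of distinct words of length $n$ that are factors (contiguous subwords) of $w$, and $E(w)=\lim_{n\to\infty}\frac1n\log p_w(n)$ (the limit always exists). For $f:\mathbb{N}\to\mathbb{R}^+$, $W(f)=\{w\in A^{\mathbb{N}}:p_w(n)\le f(n)\ \text{for all } n\in\mathbb{N}\}$, the word entropy of $f$ is $E_W(f)=\sup_{w\in W(f)}E(w)$, and the limiting lower exponential growth rate of $f$ is $E_0(f)=\liminf_{n\to\infty}\frac1n\log f(n)$. *)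

theory Defs
  imports "HOL-Analysis.Analysis"
begin

text \<open>Infinite words over the alphabet \<open>{0, ..., q - 1}\<close>.\<close>

definition infinite_words :: "nat \<Rightarrow> (nat \<Rightarrow> nat) set" where
  "infinite_words q = {w. \<forall>i. w i \<in> {0..<q}}"

definition factors :: "(nat \<Rightarrow> nat) \<Rightarrow> nat \<Rightarrow> nat list set" where
  "factors w n = {map w [i..<i + n] |i. True}"

text \<open>The set of factors is finite for every word in \<open>infinite_words q\<close>, the only words
  to which the following functions are applied.\<close>

definition complexity :: "(nat \<Rightarrow> nat) \<Rightarrow> nat \<Rightarrow> nat" where
  "complexity w n = card (factors w n)"

text \<open>The limit exists for every word in \<open>infinite_words q\<close>, since the complexity is
  positive and submultiplicative.\<close>

definition entropy :: "(nat \<Rightarrow> nat) \<Rightarrow> real" where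
  "entropy w = lim (\<lambda>n. 1 / real n * ln (real (complexity w n)))"

definition bounded_words :: "nat \<Rightarrow> (nat \<Rightarrow> real) \<Rightarrow> (nat \<Rightarrow> nat) set" where
  "bounded_words q f = {w \<in> infinite_words q. \<forall>n. real (complexity w n) \<le> f n}"

text \<open>The supremum and the limit inferior are taken in the extended reals: the latter can
  be infinite, and the former then needs no proof of boundedness.\<close>

definition word_entropy :: "nat \<Rightarrow> (nat \<Rightarrow> real) \<Rightarrow> ereal" where
  "word_entropy q f = (SUP w\<in>bounded_words q f. ereal (entropy w))"

definition lower_growth_rate :: "(nat \<Rightarrow> real) \<Rightarrow> ereal" where
  "lower_growth_rate f = liminf (\<lambda>n. ereal (1 / real n * ln (f n)))"

end

theory Submission
  imports Defs "HOL-Library.Discrete_Functions" "HOL-Real_Asymp.Real_Asymp"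
begin

text \<open>
  The word that proves the claim has sparse ones. Fix a period \<open>K\<close>, let the letters at the
  multiples of \<open>K\<close> run through a binary word that contains every finite binary word, and put
  zeros everywhere else. A window of length \<open>n \<le> K\<close> meets at most one multiple of \<open>K\<close>, so it
  contains at most one \<open>1\<close>, which leaves \<open>n + 1\<close> possibilities
  (\<open>complexity_diluted_word_short\<close>). A longer window is determined by its
  phase modulo \<open>K\<close> and about \<open>n / K\<close> free bits, all of which do occur, so that the complexity is
  \<open>2\<close> to the power \<open>n / K\<close> up to a factor that depends on \<open>K\<close> only
  (\<open>complexity_diluted_word_lower\<close>, \<open>complexity_diluted_word_upper\<close>), and the entropy is
  \<open>ln 2 / K > 0\<close>.

  If the lower growth rate of \<open>f\<close> is positive, then \<open>f n \<ge> exp (d * n)\<close> for some \<open>d > 0\<close> and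
  all \<open>n\<close> beyond some \<open>N\<close>. Taking \<open>K \<ge> N\<close>, the lengths at which only \<open>f n \<ge> n + 1\<close> is known are
  all at most \<open>K\<close>, where \<open>n + 1\<close> is enough. Since \<open>ln (8 * K) / K\<close> tends to \<open>0\<close>, a
  large \<open>K\<close> also brings the complexity down to \<open>exp (d * n)\<close> or less at all lengths beyond \<open>K\<close>.
\<close>

section \<open>A word with arbitrary bits at the multiples of a period\<close>

text \<open>The binary digits of \<open>m\<close>, lowest first and padded with zeros, fill the positions
  from \<open>2 ^ m\<close> to \<open>2 ^ Suc m - 1\<close>. Hence every finite binary word is a factor.\<close>

definition universal_word :: "nat \<Rightarrow> nat" where
  "universal_word j = of_bool (bit (floor_log j) (j - 2 ^ floor_log j))"

definition diluted_word :: "nat \<Rightarrow> nat \<Rightarrow> nat" where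
  "diluted_word K i = (if K dvd i then universal_word (i div K) else 0)"

lemma universal_word_block:
  assumes "i < 2 ^ m"
  shows "universal_word (2 ^ m + i) = of_bool (bit m i)"
proof -
  have "floor_log (2 ^ m + i) = m"
    using assms by (intro floor_log_eqI) auto
  then show ?thesis by (simp add: universal_word_def)
qed

lemma diluted_word_le_1: "diluted_word K i \<le> 1"
  by (simp add: diluted_word_def universal_word_def)

lemma diluted_word_in_infinite_words:
  assumes "q \<ge> 2"
  shows "diluted_word K \<in> infinite_words q"
proof -
  have "diluted_word K i < q" for i
    using diluted_word_le_1[of K i] assms by linarith
  then show ?thesis by (simp add: infinite_words_def)
qed

lemma factors_altdef: "factors w n = range (\<lambda>i. map (\<lambda>j. w (i + j)) [0..<n])"
proof -
  have "map w [i..<i + n] = map (\<lambda>j. w (i + j)) [0..<n]" for i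
    by (intro nth_equalityI) auto
  then show ?thesis by (auto simp: factors_def)
qed

section \<open>Complexity of the word\<close>

lemma complexity_diluted_word_short:
  assumes "n \<le> K"
  shows "complexity (diluted_word K) n \<le> n + 1"
proof -
  \<comment> \<open>the word of length \<open>n\<close> whose only \<open>1\<close> is at \<open>j\<close>, and the zero word for \<open>j = n\<close>\<close>
  define e where "e j = map (\<lambda>t. of_bool (t = j) :: nat) [0..<n]" for j
  have "map (\<lambda>j. diluted_word K (i + j)) [0..<n] \<in> e ` {..n}" for i
  proof (cases "\<exists>j<n. diluted_word K (i + j) = 1")
    case True
    then obtain j where j: "j < n" "diluted_word K (i + j) = 1" by blast
    have "diluted_word K (i + t) = of_bool (t = j)" if "t < n" for t
    proof (cases "diluted_word K (i + t) = 0")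
      case True
      then show ?thesis using j by auto
    next
      case False
      then have "K dvd i + t" "K dvd i + j"
        using j by (auto simp: diluted_word_def split: if_splits)
      then have "K dvd t - j" "K dvd j - t"
        using dvd_diff_nat[of K "i + t" "i + j"] dvd_diff_nat[of K "i + j" "i + t"] by simp_all
      then have "t = j"
        using that j(1) assms by (auto dest!: dvd_imp_le)
      then show ?thesis using j by simp
    qed
    then have "map (\<lambda>j. diluted_word K (i + j)) [0..<n] = e j"
      by (simp add: e_def)
    then show ?thesis using j by auto
  next
    case False
    have "diluted_word K (i + t) = of_bool (t = n)" if "t < n" for t
      using False that diluted_word_le_1[of K "i + t"] by (auto simp: le_Suc_eq)
    then have "map (\<lambda>j. diluted_word K (i + j)) [0..<n] = e n"
      by (simp add: e_def)
    then show ?thesis by auto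
  qed
  then have sub: "factors (diluted_word K) n \<subseteq> e ` {..n}"
    by (auto simp: factors_altdef)
  have "card (factors (diluted_word K) n) \<le> card (e ` {..n})"
    by (rule card_mono) (use sub in auto)
  also have "\<dots> \<le> card {..n}"
    by (rule card_image_le) auto
  finally show ?thesis by (simp add: complexity_def)
qed

text \<open>A factor that starts at \<open>K * a + s\<close> with \<open>s < K\<close> is determined by the phase \<open>s\<close> and by
  the letters of the universal word at the positions from \<open>a\<close> to \<open>a + n div K + 1\<close>.\<close>

lemma factors_diluted_word_subset:
  assumes "K > 0"
  defines "g \<equiv> \<lambda>n (s, T). map (\<lambda>j. of_bool (K dvd s + j \<and> (s + j) div K \<in> T)) [0..<n]"
  shows "factors (diluted_word K) n \<subseteq> g n ` ({..<K} \<times> Pow {..<n div K + 2})"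
proof -
  have "map (\<lambda>j. diluted_word K (i + j)) [0..<n] \<in> g n ` ({..<K} \<times> Pow {..<n div K + 2})" for i
  proof -
    define a s where "a = i div K" and "s = i mod K"
    have i: "i = K * a + s" and s: "s < K"
      using assms by (simp_all add: a_def s_def)
    define T where "T = {t. t < n div K + 2 \<and> universal_word (a + t) = 1}"
    have "diluted_word K (i + j) = of_bool (K dvd s + j \<and> (s + j) div K \<in> T)" if "j < n" for j
    proof -
      have "(s + j) div K \<le> (K + n) div K"
        using s that by (intro div_le_mono) simp
      also have "\<dots> = n div K + 1"
        using assms by simp
      finally have in_range: "(s + j) div K < n div K + 2" by simp
      have dvd: "K dvd i + j \<longleftrightarrow> K dvd s + j"
        by (simp add: i add.assoc dvd_add_right_iff)
      have quot: "(i + j) div K = a + (s + j) div K"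
        using assms by (simp add: i add.assoc)
      show ?thesis
        using in_range by (simp add: diluted_word_def dvd quot T_def universal_word_def)
    qed
    then have "map (\<lambda>j. diluted_word K (i + j)) [0..<n] = g n (s, T)"
      by (simp add: g_def)
    then show ?thesis
      using s by (auto simp: T_def)
  qed
  then show ?thesis by (auto simp: factors_altdef)
qed

lemma
  assumes "K > 0"
  shows finite_factors_diluted_word: "finite (factors (diluted_word K) n)"
    and complexity_diluted_word_upper: "complexity (diluted_word K) n \<le> 4 * K * 2 ^ (n div K)"
proof -
  let ?D = "{..<K} \<times> Pow {..<n div K + 2}"
  obtain g where g: "factors (diluted_word K) n \<subseteq> g ` ?D"
    using factors_diluted_word_subset[OF assms] by blast
  show "finite (factors (diluted_word K) n)"
    by (rule finite_subset[OF g]) auto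
  have "card (factors (diluted_word K) n) \<le> card (g ` ?D)"
    by (rule card_mono[OF _ g]) auto
  also have "\<dots> \<le> card ?D"
    by (rule card_image_le) auto
  also have "\<dots> = 4 * K * 2 ^ (n div K)"
    by (simp add: card_Pow)
  finally show "complexity (diluted_word K) n \<le> 4 * K * 2 ^ (n div K)"
    by (simp add: complexity_def)
qed

text \<open>With \<open>N = n div K\<close>, the factor at \<open>K * 2 ^ m\<close> shows the lowest \<open>N\<close> bits of \<open>m\<close>. The
  numbers \<open>m\<close> from \<open>2 ^ N\<close> to \<open>2 ^ Suc N - 1\<close> realise all bit patterns, and they are large enough
  for the block of \<open>m\<close> in the universal word to have at least \<open>N\<close> letters.\<close>

lemma complexity_diluted_word_lower:
  assumes "K > 0"
  shows "2 ^ (n div K) \<le> complexity (diluted_word K) n"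
proof -
  define N where "N = n div K"
  define h where "h m = map (\<lambda>j. diluted_word K (K * 2 ^ (2 ^ N + m) + j)) [0..<n]" for m
  have inj: "inj_on h {..<2 ^ N}"
  proof (rule inj_onI)
    fix m m' :: nat
    assume m: "m \<in> {..<2 ^ N}" "m' \<in> {..<2 ^ N}" and eq: "h m = h m'"
    have bit_h: "h m ! (K * i) = of_bool (bit m i)" if "i < N" "m < 2 ^ N" for m i
    proof -
      have "K * Suc i \<le> K * N"
        using that by (intro mult_le_mono2) simp
      also have "\<dots> \<le> n"
        by (simp add: N_def)
      finally have "K * i < n" using assms by simp
      have "i < 2 ^ N" using that less_exp[of N] by linarith
      also have "(2::nat) ^ N \<le> 2 ^ 2 ^ N"
        by (intro power_increasing less_imp_le less_exp) simp
      also have "\<dots> \<le> 2 ^ (2 ^ N + m)"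
        by (intro power_increasing) auto
      finally have i: "i < 2 ^ (2 ^ N + m)" .
      have "bit (2 ^ N + m) i = bit (take_bit N (2 ^ N + m)) i"
        using that by (simp add: bit_take_bit_iff)
      also have "take_bit N (2 ^ N + m) = m"
        using that by (simp add: take_bit_eq_mod)
      finally have low: "bit (2 ^ N + m) i = bit m i" .
      have "h m ! (K * i) = diluted_word K (K * (2 ^ (2 ^ N + m) + i))"
        using \<open>K * i < n\<close> by (simp add: h_def distrib_left)
      also have "\<dots> = of_bool (bit m i)"
        using assms universal_word_block[OF i] low by (simp add: diluted_word_def)
      finally show ?thesis .
    qed
    have "bit m i = bit m' i" if "i < N" for i
    proof -
      have "(of_bool (bit m i) :: nat) = of_bool (bit m' i)"
        using bit_h[of i m] bit_h[of i m'] that m eq by simp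
      then show ?thesis by (simp only: of_bool_eq_iff)
    qed
    then have "take_bit N m = take_bit N m'"
      by (auto simp: bit_eq_iff bit_take_bit_iff)
    then show "m = m'"
      using m by (simp add: take_bit_eq_mod)
  qed
  have "h ` {..<2 ^ N} \<subseteq> factors (diluted_word K) n"
    by (auto simp: h_def factors_altdef)
  then have "card (h ` {..<2 ^ N}) \<le> complexity (diluted_word K) n"
    unfolding complexity_def by (rule card_mono[OF finite_factors_diluted_word[OF assms]])
  then show ?thesis
    using inj by (simp add: card_image N_def)
qed

section \<open>Entropy of the word\<close>

lemma ln_complexity_diluted_word_upper:
  assumes "K > 0"
  shows "ln (complexity (diluted_word K) n) \<le> ln (4 * real K) + n * (ln 2 / K)"
proof -
  have pos: "complexity (diluted_word K) n > 0"
    by (rule less_le_trans[OF _ complexity_diluted_word_lower[OF assms]]) simp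
  have "ln (real (complexity (diluted_word K) n)) \<le> ln (real (4 * K * 2 ^ (n div K)))"
    using pos complexity_diluted_word_upper[OF assms, of n]
    by (intro ln_mono) (simp_all only: of_nat_0_less_iff of_nat_le_iff)
  also have "\<dots> = ln (4 * real K) + real (n div K) * ln 2"
    using assms by (simp add: ln_mult ln_realpow)
  also have "real (n div K) * ln 2 \<le> n / K * ln 2"
    by (intro mult_right_mono of_nat_div_le_of_nat) auto
  finally show ?thesis by simp
qed

lemma ln_complexity_diluted_word_lower:
  assumes "K > 0"
  shows "- ln 2 + n * (ln 2 / K) \<le> ln (complexity (diluted_word K) n)"
proof -
  have "real n = K * real (n div K) + real (n mod K)"
    by (metis mult_div_mod_eq of_nat_add of_nat_mult)
  also have "\<dots> \<le> K * (real (n div K) + 1)"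
    using assms by (simp add: distrib_left less_imp_le)
  finally have "n / K - 1 \<le> real (n div K)"
    using assms by (simp add: field_simps)
  then have "(n / K - 1) * ln 2 \<le> real (n div K) * ln 2"
    by (intro mult_right_mono) auto
  also have "\<dots> = ln (real (2 ^ (n div K)))"
    by (simp add: ln_realpow)
  also have "\<dots> \<le> ln (complexity (diluted_word K) n)"
    using complexity_diluted_word_lower[OF assms, of n]
    by (intro ln_mono) (simp_all only: of_nat_le_iff, simp)
  finally show ?thesis by (simp add: algebra_simps)
qed

lemma entropy_diluted_word:
  assumes "K > 0"
  shows "entropy (diluted_word K) = ln 2 / K"
  unfolding entropy_def
proof (rule limI, rule tendsto_sandwich)
  have affine: "(\<lambda>n. 1 / real n * (a + n * L)) \<longlonglongrightarrow> L" for a L :: real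
  proof -
    have "(\<lambda>n. a * (1 / real n) + L) \<longlonglongrightarrow> a * 0 + L"
      by (intro tendsto_intros lim_1_over_n)
    moreover have "\<forall>\<^sub>F n in sequentially. a * (1 / real n) + L = 1 / real n * (a + n * L)"
      using eventually_gt_at_top[of 0] by eventually_elim (simp add: field_simps)
    ultimately show ?thesis
      by (simp add: tendsto_cong)
  qed
  show "(\<lambda>n. 1 / real n * (- ln 2 + n * (ln 2 / K))) \<longlonglongrightarrow> ln 2 / K"
    by (rule affine)
  show "(\<lambda>n. 1 / real n * (ln (4 * real K) + n * (ln 2 / K))) \<longlonglongrightarrow> ln 2 / K"
    by (rule affine)
  show "\<forall>\<^sub>F n in sequentially. 1 / real n * (- ln 2 + n * (ln 2 / K))
          \<le> 1 / real n * ln (complexity (diluted_word K) n)"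
    using ln_complexity_diluted_word_lower[OF assms]
    by (intro always_eventually allI mult_left_mono) auto
  show "\<forall>\<^sub>F n in sequentially. 1 / real n * ln (complexity (diluted_word K) n)
          \<le> 1 / real n * (ln (4 * real K) + n * (ln 2 / real K))"
    using ln_complexity_diluted_word_upper[OF assms]
    by (intro always_eventually allI mult_left_mono) auto
qed

section \<open>Positive word entropy\<close>

lemma lower_growth_rate_pos_imp_exp_le:
  assumes "lower_growth_rate f > 0" and "\<And>n. f n > 0"
  obtains d N where "d > 0" "\<And>n. n \<ge> N \<Longrightarrow> exp (d * real n) \<le> f n"
proof -
  obtain d :: real where d: "0 < ereal d" "ereal d < lower_growth_rate f"
    using ereal_dense2[OF assms(1)] by auto
  have "\<forall>\<^sub>F n in sequentially. ereal d < ereal (1 / real n * ln (f n))"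
    using d(2) unfolding lower_growth_rate_def by (rule less_LiminfD)
  then have "\<forall>\<^sub>F n in sequentially. exp (d * real n) \<le> f n"
    using eventually_gt_at_top[of 0]
  proof eventually_elim
    case (elim n)
    then have "d * real n \<le> ln (f n)" by (simp add: field_simps)
    then show ?case using assms(2)[of n] by (simp add: ln_ge_iff)
  qed
  then obtain N where "\<forall>n\<ge>N. exp (d * real n) \<le> f n"
    by (auto simp: eventually_sequentially)
  then show thesis using d(1) that by auto
qed

theorem proposition6p1:
  fixes q :: nat and f :: "nat \<Rightarrow> real"
  assumes "q \<ge> 2"
    and "\<And>n. f n > 0"
    and "\<And>n. f n \<ge> real n + 1"
    and "lower_growth_rate f > 0"
  shows "word_entropy q f > 0"
proof -
  obtain d N where d: "d > 0" and N: "\<And>n. n \<ge> N \<Longrightarrow> exp (d * real n) \<le> f n"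
    using lower_growth_rate_pos_imp_exp_le[OF assms(4,2)] by blast
  have "(\<lambda>k::nat. ln (8 * real k) / real k) \<longlonglongrightarrow> 0"
    by real_asymp
  then have "\<forall>\<^sub>F k::nat in sequentially. ln (8 * real k) / real k < d"
    using d by (rule order_tendstoD)
  then have "\<forall>\<^sub>F k::nat in sequentially. ln (8 * real k) / real k < d \<and> k \<ge> N \<and> k > 0"
    by (intro eventually_conj eventually_ge_at_top eventually_gt_at_top)
  then obtain K :: nat where K: "ln (8 * real K) / K < d" "K \<ge> N" "K > 0"
    by (auto simp: eventually_sequentially)
  have "real (complexity (diluted_word K) n) \<le> f n" for n
  proof (cases "n \<le> K")
    case True
    have "real (complexity (diluted_word K) n) \<le> real n + 1"
      using complexity_diluted_word_short[OF True] by linarith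
    also have "\<dots> \<le> f n" by (rule assms(3))
    finally show ?thesis .
  next
    case False
    have pos: "complexity (diluted_word K) n > 0"
      by (rule less_le_trans[OF _ complexity_diluted_word_lower[OF K(3)]]) simp
    have "ln (complexity (diluted_word K) n) \<le> ln (4 * real K) + n * (ln 2 / K)"
      by (rule ln_complexity_diluted_word_upper[OF K(3)])
    \<comment> \<open>as \<open>n \<ge> K\<close>, the constant term is absorbed into the linear one\<close>
    also have "ln (4 * real K) * 1 \<le> ln (4 * real K) * (n / K)"
      using False K(3) by (intro mult_left_mono) auto
    then have "ln (4 * real K) + n * (ln 2 / K) \<le> (ln (4 * real K) + ln 2) / K * n"
      by (simp add: add_divide_distrib algebra_simps)
    also have "ln (4 * real K) + ln 2 = ln (8 * real K)"
      using K(3) ln_mult[of "4 * real K" 2] by simp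
    also have "ln (8 * real K) / K * n \<le> d * n"
      using K(1) by (intro mult_right_mono) auto
    finally have "exp (ln (complexity (diluted_word K) n)) \<le> exp (d * n)" by simp
    then have "real (complexity (diluted_word K) n) \<le> exp (d * n)"
      using pos by simp
    also have "\<dots> \<le> f n"
      using N K(2) False by simp
    finally show ?thesis .
  qed
  then have "diluted_word K \<in> bounded_words q f"
    using diluted_word_in_infinite_words[OF assms(1)] by (simp add: bounded_words_def)
  then have "ereal (entropy (diluted_word K)) \<le> word_entropy q f"
    unfolding word_entropy_def by (rule SUP_upper)
  moreover have "0 < ereal (entropy (diluted_word K))"
    using K(3) by (simp add: entropy_diluted_word)
  ultimately show ?thesis by (metis less_le_trans)
qed

end
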